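(* Let $\alpha\in(0,1)$ be irrational, $\rho\in[0,1)$, let $s_{\alpha,\rho}=a_0a_1a_2\cdots$ be a Sturmian word of angle $\alpha$ and initial point $\rho$, let $m\geq1$ and $n\geq0$ be integers, and put $$A=\left\lfloor\frac{\{-\rho-n\alpha\}}{\{m\alpha\}}\right\rfloor,\qquad B=\left\lfloor\frac{\{\rho+n\alpha\}}{\{-m\alpha\}}\right\rfloor .$$ Let $k_{m,n}$ be the maximum exponent of a (possibly degenerated) abelian power of period $m$ starting at position $n$ in $s_{\alpha,\rho}$. \begin{enumerate} \item[(i)] If $\{\rho+n\alpha\}\notin\{\{-rm\alpha\}: r\geq0\}$ ($r$ an integer), then $k_{m,n}=\max(A,B)$. \item[(ii)] If $\{\rho+n\alpha\}=0$, then $k_{m,n}=\lfloor 1/\{m\alpha\}\rfloor$ if $0\in I_b$, and $k_{m,n}=\lfloor 1/\{-m\alpha\}\rfloor$ if $0\notin I_b$. \item[(iii)] If $\{\rho+n\alpha\}=\{-rm\alpha\}$ for some integer $r>0$ and $r>\max(A,B)$, then $k_{m,n}=\max(A,B)$. \item[(iv)] If $\{\rho+n\alpha\}=\{-rm\alpha\}$ for some integer $r>0$ and $r\leq\max(A,B)$, then $k_{m,n}=\max(A-\gamma,\,B+\gamma-1)$, where $\gamma=1$ if $0\in I_b$ and $\gamma=0$ if $0\notin I_b$. \end{enumerate}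
   Context: $\{x\}=x-\lfloor x\rfloor$ is the fractional part. For irrational $\alpha\in(0,1)$ and $\rho\in[0,1)$, a Sturmian word $s_{\alpha,\rho}$ of angle $\alpha$ and initial point $\rho$ is the infinite word $a_0a_1a_2\cdots$ over $\{a,b\}$ with $a_n=b$ if $\{\rho+n\alpha\}\in I_b$ and $a_n=a$ if $\{\rho+n\alpha\}\in I_a$, where one of two choices is made: either $I_b=[0,1-\alpha)$, $I_a=[1-\alpha,1)$ (this choice is expressed by "$0\in I_b$"), or $I_b=(0,1-\alpha]$, $I_a=(1-\alpha,1]$ with the point $0$ identified with $1$ (this choice is expressed by "$0\notin I_b$"). Positions are counted from $0$. The Parikh vector of a word over $\{a,b\}$ is the pair (number of $a$'s, number of $b$'s). A word $w$ is an abelian power of period $m$ and exponent $k$ if $w=u_1u_2\cdots u_k$ with $|u_1|=\dots=|u_k|=m$ and all $u_i$ having the same Parikh vector; it is degenerated if $k=1$. Thus $k_{m,n}\ge 1$ is the largest integer $k\geq1$ such that $a_n a_{n+1}\cdots a_{n+km-1}$ is an abelian power of period $m$ and exponent $k$ ($k=1$ allowed). *)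

theory Defs
  imports Complex_Main
begin

datatype letter = La | Lb

text \<open>
  The two admissible choices of the pair \<open>(I\<^sub>b, I\<^sub>a)\<close>. In the second one the point 0 of the circle
  is identified with 1; since \<^term>\<open>frac\<close> takes values in \<open>[0,1)\<close>, the identification amounts to
  0 belonging to \<open>I\<^sub>a\<close>.
\<close>

definition sturmian_coding :: "real \<Rightarrow> real set \<Rightarrow> real set \<Rightarrow> bool" where
  "sturmian_coding \<alpha> Ib Ia \<longleftrightarrow>
     (Ib = {0..<1 - \<alpha>} \<and> Ia = {1 - \<alpha>..<1}) \<or>
     (Ib = {0<..1 - \<alpha>} \<and> Ia = insert 0 {1 - \<alpha><..1})"

definition sturmian_word ::
    "real \<Rightarrow> real \<Rightarrow> real set \<Rightarrow> real set \<Rightarrow> (nat \<Rightarrow> letter) \<Rightarrow> bool" where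
  "sturmian_word \<alpha> \<rho> Ib Ia s \<longleftrightarrow>
     sturmian_coding \<alpha> Ib Ia \<and>
     (\<forall>n. (frac (\<rho> + real n * \<alpha>) \<in> Ib \<longrightarrow> s n = Lb) \<and>
          (frac (\<rho> + real n * \<alpha>) \<in> Ia \<longrightarrow> s n = La))"

definition parikh :: "letter list \<Rightarrow> nat \<times> nat" where
  "parikh w = (count_list w La, count_list w Lb)"

definition abelian_power :: "nat \<Rightarrow> nat \<Rightarrow> letter list \<Rightarrow> bool" where
  "abelian_power m k w \<longleftrightarrow>
     k \<ge> 1 \<and>
     (\<exists>us. w = concat us \<and> length us = k \<and> (\<forall>u\<in>set us. length u = m) \<and>
           (\<forall>u\<in>set us. \<forall>v\<in>set us. parikh u = parikh v))"

definition factor :: "(nat \<Rightarrow> letter) \<Rightarrow> nat \<Rightarrow> nat \<Rightarrow> letter list" where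
  "factor s n l = map s [n..<n + l]"

text \<open>
  The set below always contains 1 if \<open>m \<ge> 1\<close>, and for a Sturmian word (with irrational angle)
  it is finite, so that \<^const>\<open>Max\<close> is its genuine maximum.
\<close>

definition max_exponent :: "(nat \<Rightarrow> letter) \<Rightarrow> nat \<Rightarrow> nat \<Rightarrow> nat" where
  "max_exponent s m n = Max {k. abelian_power m k (factor s n (k * m))}"

end

theory Submission
  imports Defs
begin

text \<open>
  The number of letters \<open>a\<close> in a block is the increment along that block of \<open>\<lfloor>\<rho> + p\<alpha>\<rfloor>\<close> if
  \<open>0 \<in> I\<^sub>b\<close>, and of \<open>\<lceil>\<rho> + p\<alpha>\<rceil>\<close> if \<open>0 \<notin> I\<^sub>b\<close>. With \<open>f = {\<rho> + n\<alpha>}\<close> and \<open>\<theta> = {m\<alpha>}\<close>, the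
  \<open>i\<close>-th block of length \<open>m\<close> therefore contains, up to a constant, \<open>\<lfloor>f + (i+1)\<theta>\<rfloor> - \<lfloor>f + i\<theta>\<rfloor>\<close>
  letters \<open>a\<close> (respectively the same with ceilings). These increments are 0 or 1, so the first \<open>k\<close> of
  them agree iff their sum is \<open>0\<close> or \<open>k\<close>, that is, iff \<open>f + k\<theta> < 1\<close> or \<open>k(1 - \<theta>) \<le> f\<close>
  (respectively, for \<open>f > 0\<close>, iff \<open>f + k\<theta> \<le> 1\<close> or \<open>k(1 - \<theta>) < f\<close>). This gives the maximum of \<open>A\<close> and
  \<open>B\<close>, except when \<open>f + r\<theta> = 1\<close> or \<open>r(1 - \<theta>) = f\<close>, which can happen only for the \<open>r\<close> with
  \<open>f = {-rm\<alpha>}\<close>; then strict and weak inequality have to be distinguished.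
\<close>

section \<open>Abelian powers as runs of consecutive blocks\<close>

lemma factor_add: "factor s n (k + l) = factor s n k @ factor s (n + k) l"
  using upt_add_eq_append[of n "n + k" l] by (simp add: factor_def add.assoc)

lemma factor_mult_eq_concat:
  "factor s n (k * m) = concat (map (\<lambda>i. factor s (n + i * m) m) [0..<k])"
proof (induction k)
  case 0
  show ?case by (simp add: factor_def)
next
  case (Suc k)
  have "factor s n (Suc k * m) = factor s n (k * m) @ factor s (n + k * m) m"
    using factor_add[of s n "k * m" m] by (simp add: add.commute)
  then show ?case using Suc by simp
qed

lemma length_factor [simp]: "length (factor s n l) = l"
  by (simp add: factor_def)

text \<open>Since all pieces have length \<open>m\<close>, the word can be cut in only one way, so
  the existential witness must be the list of consecutive factors.\<close>

lemma abelian_power_factor_iff: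
  "abelian_power m k (factor s n (k * m)) \<longleftrightarrow>
     k \<ge> 1 \<and> (\<forall>i<k. parikh (factor s (n + i * m) m) = parikh (factor s n m))"
  (is "?L \<longleftrightarrow> _")
proof -
  let ?vs = "map (\<lambda>i. factor s (n + i * m) m) [0..<k]"
  have blocks: "us = ?vs"
    if "factor s n (k * m) = concat us" "length us = k" "\<forall>u\<in>set us. length u = m" for us
  proof (rule concat_injective)
    show "concat us = concat ?vs"
      using that(1) factor_mult_eq_concat[of s n k m] by (rule trans[OF sym])
    show "length us = length ?vs" using that(2) by simp
    have "length x = m" "length y = m" if "(x, y) \<in> set (zip us ?vs)" for x y
      using set_zip_leftD[OF that] set_zip_rightD[OF that] \<open>\<forall>u\<in>set us. length u = m\<close> by auto
    then show "\<forall>(x, y)\<in>set (zip us ?vs). length x = length y" by fastforce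
  qed
  define h where "h i = parikh (factor s (n + i * m) m)" for i
  have vs: "(\<forall>u\<in>set ?vs. \<forall>v\<in>set ?vs. parikh u = parikh v) \<longleftrightarrow> (\<forall>i<k. \<forall>j<k. h i = h j)"
    unfolding h_def set_map set_upt ball_simps(9)
    by (simp only: Ball_def atLeastLessThan_iff le0 simp_thms)
  have "?L \<longleftrightarrow> k \<ge> 1 \<and> (\<forall>i<k. \<forall>j<k. h i = h j)"
    unfolding vs[symmetric]
  proof
    assume ?L
    then obtain us where us: "k \<ge> 1" "factor s n (k * m) = concat us" "length us = k"
        "\<forall>u\<in>set us. length u = m" "\<forall>u\<in>set us. \<forall>v\<in>set us. parikh u = parikh v"
      unfolding abelian_power_def by (elim conjE exE) (rule that)
    show "k \<ge> 1 \<and> (\<forall>u\<in>set ?vs. \<forall>v\<in>set ?vs. parikh u = parikh v)"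
      using us(1,5) unfolding blocks[OF us(2-4)] by (rule conjI)
  next
    assume R: "k \<ge> 1 \<and> (\<forall>u\<in>set ?vs. \<forall>v\<in>set ?vs. parikh u = parikh v)"
    have "length ?vs = k" "\<forall>u\<in>set ?vs. length u = m" by simp_all
    with R show ?L
      unfolding abelian_power_def
      by (intro conjI exI[of _ ?vs] factor_mult_eq_concat) (elim conjE; assumption)+
  qed
  also have "\<dots> \<longleftrightarrow> k \<ge> 1 \<and> (\<forall>i<k. h i = h 0)"
    by (metis less_le_trans zero_less_one)
  finally show ?thesis unfolding h_def mult_zero_left add_0_right .
qed

section \<open>Letter counts as telescoping increments\<close>

lemma count_list_La_Lb: "count_list w La + count_list w Lb = length w"
proof (induction w)
  case (Cons x w)
  then show ?case by (cases x) auto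
qed simp

lemma parikh_eq_iff:
  "length u = length v \<Longrightarrow> parikh u = parikh v \<longleftrightarrow> count_list u La = count_list v La"
  using count_list_La_Lb[of u] count_list_La_Lb[of v] by (auto simp: parikh_def)

text \<open>\<open>c\<close> stays abstract because it is instantiated both with floors and with
  ceilings of \<rho> + p\<alpha>.\<close>

lemma count_list_factor_telescope:
  fixes c :: "nat \<Rightarrow> int"
  assumes "\<And>p. c (Suc p) - c p = (if s p = La then 1 else 0)"
  shows "int (count_list (factor s p l) La) = c (p + l) - c p"
proof (induction l)
  case 0
  show ?case by (simp add: factor_def)
next
  case (Suc l)
  then show ?case using assms[of "p + l"] by (simp add: factor_def split: if_splits)
qed

lemma increments_const_iff:
  fixes g :: "nat \<Rightarrow> int"
  assumes "k \<ge> 1" and step: "\<And>i. g (Suc i) - g i \<in> {0, 1}"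
  shows "(\<forall>i<k. g (Suc i) - g i = g 1 - g 0) \<longleftrightarrow> g k = g 0 \<or> g k = g 0 + int k"
proof -
  have lo: "g i \<le> g j" and hi: "g j \<le> g i + int (j - i)" if "i \<le> j" for i j
    using that
  proof (induction j rule: dec_induct)
    case (step n)
    have inc: "g n \<le> g (Suc n)" "g (Suc n) \<le> g n + 1" using assms(2)[of n] by auto
    { case 1 show ?case using step.IH(1) inc(1) by (rule order_trans) }
    { case 2 show ?case using step.IH(2) inc(2) step.hyps by (simp add: Suc_diff_le) }
  qed simp_all
  show ?thesis
  proof
    assume L: "\<forall>i<k. g (Suc i) - g i = g 1 - g 0"
    define d where "d = g 1 - g 0"
    have "g j = g 0 + int j * d" if "j \<le> k" for j
      using that
    proof (induction j)
      case (Suc j)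
      then have "g (Suc j) - g j = d" using L Suc_le_lessD unfolding d_def by blast
      then have "g (Suc j) = g j + d" by linarith
      also have "\<dots> = g 0 + int (Suc j) * d" using Suc by (simp add: distrib_right)
      finally show ?case .
    qed simp
    from this[of k] have "g k = g 0 + int k * d" by simp
    moreover have "d = 0 \<or> d = 1" using step[of 0] unfolding d_def One_nat_def by blast
    ultimately show "g k = g 0 \<or> g k = g 0 + int k" by (elim disjE) simp_all
  next
    assume R: "g k = g 0 \<or> g k = g 0 + int k"
    \<comment> \<open>With \<open>g k\<close> extreme, the bounds on the increments before and after
      step \<open>i\<close> leave only one value for that step.\<close>
    have const: "g (Suc i) - g i = (if g k = g 0 then 0 else 1)" if "i < k" for i
    proof -
      have "int (k - Suc i) = int k - int i - 1" using that by linarith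
      then have "g 0 \<le> g i" "g i \<le> g 0 + int i" "g (Suc i) \<le> g k"
          "g k \<le> g (Suc i) + int k - int i - 1"
        using lo[of 0 i] lo[of "Suc i" k] hi[of 0 i] hi[of "Suc i" k] that by simp_all
      moreover have "g (Suc i) = g i \<or> g (Suc i) = g i + 1" using assms(2)[of i] by auto
      ultimately show ?thesis using R \<open>k \<ge> 1\<close> by (elim disjE; cases "g k = g 0"; simp)
    qed
    have "g 1 - g 0 = (if g k = g 0 then 0 else 1)" using const[of 0] \<open>k \<ge> 1\<close> by simp
    then show "\<forall>i<k. g (Suc i) - g i = g 1 - g 0" using const by metis
  qed
qed

section \<open>Sturmian words through floors and ceilings\<close>

text \<open>In both codings \<open>La\<close> marks the steps at which adding \<alpha> changes the
  rounded value. Floors jump when an integer is reached or passed, matching [1 - \<alpha>, 1);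
  ceilings jump when an integer is left or strictly passed, matching 0 and (1 - \<alpha>,
  1).\<close>

lemma sturmian_word_counts:
  assumes "0 < \<alpha>" "\<alpha> < 1" "sturmian_word \<alpha> \<rho> Ib Ia s"
  shows "0 \<in> Ib \<Longrightarrow>
      \<lfloor>\<rho> + real (Suc p) * \<alpha>\<rfloor> - \<lfloor>\<rho> + real p * \<alpha>\<rfloor> = (if s p = La then 1 else 0)"
    and "0 \<notin> Ib \<Longrightarrow>
      \<lceil>\<rho> + real (Suc p) * \<alpha>\<rceil> - \<lceil>\<rho> + real p * \<alpha>\<rceil> = (if s p = La then 1 else 0)"
proof -
  define y where "y = \<rho> + real p * \<alpha>"
  have y': "\<rho> + real (Suc p) * \<alpha> = of_int \<lfloor>y\<rfloor> + (frac y + \<alpha>)"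
    by (simp add: y_def frac_def algebra_simps)
  have y: "y = of_int \<lfloor>y\<rfloor> + frac y" by (simp add: frac_def)
  have f: "0 \<le> frac y" "frac y < 1" by (auto simp: frac_lt_1)
  have s: "frac y \<in> Ib \<Longrightarrow> s p = Lb" "frac y \<in> Ia \<Longrightarrow> s p = La"
    using assms(3) by (auto simp: sturmian_word_def y_def)
  { assume "0 \<in> Ib"
    then have I: "Ib = {0..<1 - \<alpha>}" "Ia = {1 - \<alpha>..<1}"
      using assms by (auto simp: sturmian_word_def sturmian_coding_def)
    have "\<lfloor>frac y + \<alpha>\<rfloor> = (if s p = La then 1 else 0)"
    proof (cases "frac y < 1 - \<alpha>")
      case True
      then show ?thesis using f s(1) assms I by (auto simp: floor_eq_iff)
    next
      case False
      then show ?thesis using f s(2) assms I by (auto simp: floor_eq_iff)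
    qed
    then show "\<lfloor>\<rho> + real (Suc p) * \<alpha>\<rfloor> - \<lfloor>\<rho> + real p * \<alpha>\<rfloor> = (if s p = La then 1 else 0)"
      unfolding y' y_def[symmetric] by simp }
  { assume "0 \<notin> Ib"
    then have I: "Ib = {0<..1 - \<alpha>}" "Ia = insert 0 {1 - \<alpha><..1}"
      using assms by (auto simp: sturmian_word_def sturmian_coding_def)
    have "\<lceil>frac y + \<alpha>\<rceil> - \<lceil>frac y\<rceil> = (if s p = La then 1 else 0)"
    proof (cases "frac y = 0")
      case True
      then show ?thesis using s(2) assms I by (auto simp: ceiling_eq_iff simp del: frac_eq_0_iff)
    next
      case nz: False
      then have "0 < frac y" using f by linarith
      then have c: "\<lceil>frac y\<rceil> = 1" using f by (simp add: ceiling_eq_iff)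
      show ?thesis
      proof (cases "frac y \<le> 1 - \<alpha>")
        case True
        then show ?thesis using f s(1) assms I \<open>0 < frac y\<close> unfolding c by (auto simp: ceiling_eq_iff simp del: frac_eq_0_iff frac_gt_0_iff)
      next
        case False
        then show ?thesis using f s(2) assms I \<open>0 < frac y\<close> unfolding c by (auto simp: ceiling_eq_iff simp del: frac_eq_0_iff frac_gt_0_iff)
      qed
    qed
    moreover have "\<lceil>y\<rceil> = \<lfloor>y\<rfloor> + \<lceil>frac y\<rceil>"
      by (metis add.commute ceiling_add_of_int y)
    ultimately show "\<lceil>\<rho> + real (Suc p) * \<alpha>\<rceil> - \<lceil>\<rho> + real p * \<alpha>\<rceil> = (if s p = La then 1 else 0)"
      unfolding y' y_def[symmetric]
      by (simp add: add.commute[of "of_int _"]) }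
qed

text \<open>The linear part \<open>d + int i * e\<close> contributes the same \<open>e\<close> to
  every block, so only the increments of the remainder \<open>g\<close> can tell blocks
  apart.\<close>

lemma abelian_power_iff_increments:
  fixes c :: "nat \<Rightarrow> int" and g :: "nat \<Rightarrow> int" and d e :: int
  assumes "\<And>p. c (Suc p) - c p = (if s p = La then 1 else 0)"
    and c: "\<And>i. c (n + i * m) = d + int i * e + g i"
    and "\<And>i. g (Suc i) - g i \<in> {0, 1}"
    and "k \<ge> 1"
  shows "abelian_power m k (factor s n (k * m)) \<longleftrightarrow> g k = g 0 \<or> g k = g 0 + int k"
proof -
  have count: "int (count_list (factor s (n + i * m) m) La) = e + (g (Suc i) - g i)" for i
    using count_list_factor_telescope[of c s "n + i * m" m, OF assms(1)] c[of i] c[of "Suc i"]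
    by (simp add: algebra_simps)
  have "parikh (factor s (n + i * m) m) = parikh (factor s n m) \<longleftrightarrow>
      g (Suc i) - g i = g 1 - g 0" for i
    using count[of i] count[of 0] by (subst parikh_eq_iff) auto
  then show ?thesis
    unfolding abelian_power_factor_iff increments_const_iff[of k g, OF \<open>k \<ge> 1\<close> assms(3), symmetric]
    using \<open>k \<ge> 1\<close> by simp
qed

text \<open>The three cases differ in the starting value: the floor of \<open>f\<close> is 0, its
  ceiling is 1 for f > 0 and 0 for f = 0. In the last case \<open>g k = g 0\<close> would need
  k\<theta> \<le> 0, so only one alternative survives.\<close>

lemma abelian_power_sturmian_iff:
  fixes \<alpha> \<rho> :: real and m n k :: nat
  assumes \<alpha>: "0 < \<alpha>" "\<alpha> < 1" "sturmian_word \<alpha> \<rho> Ib Ia s" and k: "k \<ge> 1"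
  defines "f \<equiv> frac (\<rho> + real n * \<alpha>)" and "\<theta> \<equiv> frac (real m * \<alpha>)"
  assumes \<theta>: "\<theta> > 0"
  shows "0 \<in> Ib \<Longrightarrow> abelian_power m k (factor s n (k * m)) \<longleftrightarrow>
            f + real k * \<theta> < 1 \<or> real k * (1 - \<theta>) \<le> f"
    and "0 \<notin> Ib \<Longrightarrow> f > 0 \<Longrightarrow> abelian_power m k (factor s n (k * m)) \<longleftrightarrow>
            f + real k * \<theta> \<le> 1 \<or> real k * (1 - \<theta>) < f"
    and "0 \<notin> Ib \<Longrightarrow> f = 0 \<Longrightarrow> abelian_power m k (factor s n (k * m)) \<longleftrightarrow>
            real k * (1 - \<theta>) < 1"
proof -
  have f: "0 \<le> f" "f < 1" and \<theta>1: "\<theta> < 1"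
    by (auto simp: f_def \<theta>_def frac_lt_1)
  have x: "\<rho> + real (n + i * m) * \<alpha> =
      of_int (\<lfloor>\<rho> + real n * \<alpha>\<rfloor> + int i * \<lfloor>real m * \<alpha>\<rfloor>) + (f + real i * \<theta>)" for i
    by (simp add: f_def \<theta>_def frac_def algebra_simps)
  have k\<theta>: "real k * \<theta> > 0" "real k * \<theta> < real k" using k \<theta> \<theta>1 by auto
  { assume I: "0 \<in> Ib"
    have "abelian_power m k (factor s n (k * m)) \<longleftrightarrow>
        \<lfloor>f + real k * \<theta>\<rfloor> = \<lfloor>f + real 0 * \<theta>\<rfloor> \<or> \<lfloor>f + real k * \<theta>\<rfloor> = \<lfloor>f + real 0 * \<theta>\<rfloor> + int k"
    proof (rule abelian_power_iff_increments[where c = "\<lambda>p. \<lfloor>\<rho> + real p * \<alpha>\<rfloor>"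
          and g = "\<lambda>i. \<lfloor>f + real i * \<theta>\<rfloor>", OF sturmian_word_counts(1)[OF \<alpha> I] _ _ k])
      show "\<lfloor>\<rho> + real (n + i * m) * \<alpha>\<rfloor> =
          \<lfloor>\<rho> + real n * \<alpha>\<rfloor> + int i * \<lfloor>real m * \<alpha>\<rfloor> + \<lfloor>f + real i * \<theta>\<rfloor>" for i
        unfolding x by (simp only: floor_add_int[symmetric] add.commute)
      show "\<lfloor>f + real (Suc i) * \<theta>\<rfloor> - \<lfloor>f + real i * \<theta>\<rfloor> \<in> {0, 1}" for i
      proof -
        have "f + real (Suc i) * \<theta> = f + real i * \<theta> + \<theta>" by (simp add: algebra_simps)
        then show ?thesis using \<theta> \<theta>1 by simp linarith
      qed
    qed
    also have "\<lfloor>f + real 0 * \<theta>\<rfloor> = 0" using f by (simp add: floor_eq_iff)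
    finally show "abelian_power m k (factor s n (k * m)) \<longleftrightarrow>
            f + real k * \<theta> < 1 \<or> real k * (1 - \<theta>) \<le> f"
      using f k\<theta> by (auto simp: floor_eq_iff algebra_simps) }
  { assume I: "0 \<notin> Ib"
    have ceil: "abelian_power m k (factor s n (k * m)) \<longleftrightarrow>
        \<lceil>f + real k * \<theta>\<rceil> = \<lceil>f + real 0 * \<theta>\<rceil> \<or> \<lceil>f + real k * \<theta>\<rceil> = \<lceil>f + real 0 * \<theta>\<rceil> + int k"
    proof (rule abelian_power_iff_increments[where c = "\<lambda>p. \<lceil>\<rho> + real p * \<alpha>\<rceil>"
          and g = "\<lambda>i. \<lceil>f + real i * \<theta>\<rceil>", OF sturmian_word_counts(2)[OF \<alpha> I] _ _ k])
      \<comment> \<open>\<open>x\<close> splits off an integer, so the linear part is built from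
        floors here too; only the remainder is rounded up.\<close>
      show "\<lceil>\<rho> + real (n + i * m) * \<alpha>\<rceil> =
          \<lfloor>\<rho> + real n * \<alpha>\<rfloor> + int i * \<lfloor>real m * \<alpha>\<rfloor> + \<lceil>f + real i * \<theta>\<rceil>" for i
        unfolding x by (simp only: ceiling_add_of_int[symmetric] add.commute)
      show "\<lceil>f + real (Suc i) * \<theta>\<rceil> - \<lceil>f + real i * \<theta>\<rceil> \<in> {0, 1}" for i
      proof -
        have "f + real (Suc i) * \<theta> = f + real i * \<theta> + \<theta>" by (simp add: algebra_simps)
        then show ?thesis using \<theta> \<theta>1 by simp linarith
      qed
    qed
    { assume "f > 0"
      then have c: "\<lceil>f + real 0 * \<theta>\<rceil> = 1" using f by (simp add: ceiling_eq_iff)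
      from ceil show "abelian_power m k (factor s n (k * m)) \<longleftrightarrow>
            f + real k * \<theta> \<le> 1 \<or> real k * (1 - \<theta>) < f"
        unfolding c using f k\<theta> \<open>f > 0\<close> by (auto simp: ceiling_eq_iff algebra_simps) }
    { assume "f = 0"
      with ceil show "abelian_power m k (factor s n (k * m)) \<longleftrightarrow> real k * (1 - \<theta>) < 1"
        using k k\<theta> \<theta>1 by (auto simp: ceiling_eq_iff algebra_simps) } }
qed

section \<open>Evaluation of the maximum exponent\<close>

text \<open>Exponent 1 is always admissible, which forces \<open>N \<ge> 1\<close>; the admissible
  exponents then form the finite nonempty interval from 1 to \<open>N\<close>.\<close>

lemma max_exponent_eqI:
  assumes "\<And>k. k \<ge> 1 \<Longrightarrow> abelian_power m k (factor s n (k * m)) \<longleftrightarrow> int k \<le> N"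
  shows "int (max_exponent s m n) = N"
proof -
  have "abelian_power m 1 (factor s n (1 * m))"
    unfolding abelian_power_factor_iff by simp
  then have N: "N \<ge> 1" using assms[of 1] by simp
  have "{k. abelian_power m k (factor s n (k * m))} = {1..nat N}"
  proof (intro equalityI subsetI)
    fix k assume "k \<in> {k. abelian_power m k (factor s n (k * m))}"
    then have k: "abelian_power m k (factor s n (k * m))" by simp
    then have "k \<ge> 1" by (simp add: abelian_power_def)
    then show "k \<in> {1..nat N}" using k assms[of k] by simp
  next
    fix k assume "k \<in> {1..nat N}"
    then show "k \<in> {k. abelian_power m k (factor s n (k * m))}" using assms[of k] N by (auto simp: le_nat_iff)
  qed
  moreover have "Max {1..nat N} = nat N" using N by (intro Max_eqI) auto
  ultimately show ?thesis using N by (simp add: max_exponent_def)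
qed

theorem corollary4p9:
  fixes \<alpha> \<rho> :: real and Ib Ia :: "real set" and s :: "nat \<Rightarrow> letter"
    and m n :: nat and A B :: int
  assumes "0 < \<alpha>" and "\<alpha> < 1" and "\<alpha> \<notin> \<rat>"
    and "0 \<le> \<rho>" and "\<rho> < 1"
    and "sturmian_word \<alpha> \<rho> Ib Ia s"
    and "m \<ge> 1"
    and "A = \<lfloor>frac (- \<rho> - real n * \<alpha>) / frac (real m * \<alpha>)\<rfloor>"
    and "B = \<lfloor>frac (\<rho> + real n * \<alpha>) / frac (- (real m * \<alpha>))\<rfloor>"
  shows
    "(frac (\<rho> + real n * \<alpha>) \<notin> {frac (- (real r * real m * \<alpha>)) | r :: nat. True} \<longrightarrow>
        int (max_exponent s m n) = max A B) \<and>
     (frac (\<rho> + real n * \<alpha>) = 0 \<longrightarrow>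
        (0 \<in> Ib \<longrightarrow> int (max_exponent s m n) = \<lfloor>1 / frac (real m * \<alpha>)\<rfloor>) \<and>
        (0 \<notin> Ib \<longrightarrow> int (max_exponent s m n) = \<lfloor>1 / frac (- (real m * \<alpha>))\<rfloor>)) \<and>
     (\<forall>r :: nat. r > 0 \<and> frac (\<rho> + real n * \<alpha>) = frac (- (real r * real m * \<alpha>)) \<and>
        int r > max A B \<longrightarrow>
        int (max_exponent s m n) = max A B) \<and>
     (\<forall>(r :: nat) (\<gamma> :: int). r > 0 \<and> frac (\<rho> + real n * \<alpha>) = frac (- (real r * real m * \<alpha>)) \<and>
        int r \<le> max A B \<and> \<gamma> = (if 0 \<in> Ib then 1 else 0) \<longrightarrow>
        int (max_exponent s m n) = max (A - \<gamma>) (B + \<gamma> - 1))"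
proof -
  define f where "f = frac (\<rho> + real n * \<alpha>)"
  define \<theta> where "\<theta> = frac (real m * \<alpha>)"
  \<comment> \<open>The only point where irrationality of \<alpha> is used; it yields \<theta> > 0
    and \<open>orbit_unique\<close>.\<close>
  have irr: "j = 0" if "real_of_int j * \<alpha> \<in> \<int>" for j
  proof (rule ccontr)
    assume "j \<noteq> 0"
    have "real_of_int j * \<alpha> \<in> \<rat>" using that Ints_subset_Rats by auto
    then have "real_of_int j * \<alpha> / real_of_int j \<in> \<rat>" by (intro Rats_divide) auto
    then show False using \<open>j \<noteq> 0\<close> assms(3) by simp
  qed
  have m\<alpha>: "real m * \<alpha> \<notin> \<int>" using irr[of "int m"] \<open>m \<ge> 1\<close> by auto
  have \<theta>: "0 < \<theta>" "\<theta> < 1"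
    using m\<alpha> by (auto simp: \<theta>_def frac_lt_1 frac_gt_0_iff)
  have \<theta>': "frac (- (real m * \<alpha>)) = 1 - \<theta>" using m\<alpha> by (simp add: frac_neg \<theta>_def)
  have f: "0 \<le> f" "f < 1" by (auto simp: f_def frac_lt_1)
  have neg_f: "frac (- \<rho> - real n * \<alpha>) = (if f = 0 then 0 else 1 - f)"
  proof -
    have "- \<rho> - real n * \<alpha> = - (\<rho> + real n * \<alpha>)" by simp
    then show ?thesis by (simp only: frac_neg f_def frac_eq_0_iff)
  qed
  have A: "k \<le> A \<longleftrightarrow> real_of_int k * \<theta> \<le> (if f = 0 then 0 else 1 - f)" for k
    unfolding assms(8) neg_f \<theta>_def[symmetric] le_floor_iff using \<theta> by (simp add: pos_le_divide_eq)
  have B: "k \<le> B \<longleftrightarrow> real_of_int k * (1 - \<theta>) \<le> f" for k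
    unfolding assms(9) \<theta>' f_def[symmetric] le_floor_iff using \<theta> by (simp add: pos_le_divide_eq)
  \<comment> \<open>Replacing m\<alpha> by \<theta> changes r m\<alpha> only by an integer.
    Integrality of \<open>f + real r * \<theta>\<close> is the form in which the boundary equalities
    appear below.\<close>
  have orbit: "f = frac (- (real r * real m * \<alpha>)) \<longleftrightarrow> f + real r * \<theta> \<in> \<int>" for r :: nat
  proof -
    have "f = frac (- (real r * real m * \<alpha>)) \<longleftrightarrow> - (real r * real m * \<alpha>) - f \<in> \<int>"
      using f frac_unique_iff[of "- (real r * real m * \<alpha>)" f] by auto
    also have "- (real r * real m * \<alpha>) - f = - (f + real r * \<theta> + of_int (int r * \<lfloor>real m * \<alpha>\<rfloor>))"
      by (simp add: \<theta>_def frac_def algebra_simps)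
    also have "\<dots> \<in> \<int> \<longleftrightarrow> f + real r * \<theta> \<in> \<int>"
      unfolding minus_in_Ints_iff by (metis Ints_add Ints_of_int Ints_diff add_diff_cancel_right')
    finally show ?thesis .
  qed
  \<comment> \<open>Up to an integer the two sums differ by (k - r)m\<alpha>, so \<open>irr\<close>
    applies.\<close>
  have orbit_unique: "k = r" if "f + real k * \<theta> \<in> \<int>" "f + real r * \<theta> \<in> \<int>" for k r :: nat
  proof -
    have "(f + real k * \<theta>) - (f + real r * \<theta>) + of_int ((int k - int r) * \<lfloor>real m * \<alpha>\<rfloor>) \<in> \<int>"
      by (rule Ints_add[OF Ints_diff[OF that] Ints_of_int])
    also have "(f + real k * \<theta>) - (f + real r * \<theta>) + of_int ((int k - int r) * \<lfloor>real m * \<alpha>\<rfloor>)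
        = real_of_int ((int k - int r) * int m) * \<alpha>"
      by (simp add: \<theta>_def frac_def algebra_simps)
    finally show ?thesis using irr \<open>m \<ge> 1\<close> by fastforce
  qed
  note ab = abelian_power_sturmian_iff[OF assms(1,2,6), of _ m n, folded f_def \<theta>_def, OF _ \<theta>(1)]

  \<comment> \<open>Away from the two boundary equalities strict and weak inequality coincide, so
    both codings give the same criterion.\<close>
  have generic: "int (max_exponent s m n) = max A B"
    if f0: "f \<noteq> 0" and no1: "\<And>k::nat. k \<ge> 1 \<Longrightarrow> f + real k * \<theta> \<noteq> 1"
      and nok: "\<And>k::nat. k \<ge> 1 \<Longrightarrow> real k * (1 - \<theta>) \<noteq> f"
  proof (rule max_exponent_eqI)
    fix k :: nat assume k: "k \<ge> 1"
    show "abelian_power m k (factor s n (k * m)) \<longleftrightarrow> int k \<le> max A B"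
      unfolding le_max_iff_disj A B
      using ab[OF k] f0 f no1[OF k] nok[OF k] by (cases "0 \<in> Ib") auto
  qed

  have zero: "int (max_exponent s m n) = \<lfloor>1 / \<theta>\<rfloor>" if f0: "f = 0" and I: "0 \<in> Ib"
  proof (rule max_exponent_eqI)
    fix k :: nat assume k: "k \<ge> 1"
    \<comment> \<open>Equality would give integers at both indices \<open>k\<close> and 0. Hence the
      strict bound in \<open>ab(1)\<close> can be read as the weak bound of a floor.\<close>
    have "real k * \<theta> \<noteq> 1" using orbit_unique[of k 0] k f0 by auto
    moreover have "real k * (1 - \<theta>) > 0" using k \<theta> by simp
    ultimately show "abelian_power m k (factor s n (k * m)) \<longleftrightarrow> int k \<le> \<lfloor>1 / \<theta>\<rfloor>"
      using ab(1)[OF k I] f0 \<theta> by (auto simp: le_floor_iff pos_le_divide_eq)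
  qed

  have zero': "int (max_exponent s m n) = \<lfloor>1 / (1 - \<theta>)\<rfloor>" if f0: "f = 0" and I: "0 \<notin> Ib"
  proof (rule max_exponent_eqI)
    fix k :: nat assume k: "k \<ge> 1"
    \<comment> \<open>Rules out k(1 - \<theta>) = 1, again by comparison with index 0.\<close>
    have "real k * \<theta> \<noteq> real k - 1"
    proof
      assume "real k * \<theta> = real k - 1"
      then have "f + real k * \<theta> = of_int (int k - 1)" using f0 by simp
      then show False using orbit_unique[of k 0] k f0 by (metis Ints_0 Ints_of_int add_0 mult_zero_left
            not_one_le_zero of_nat_0)
    qed
    then have "real k * (1 - \<theta>) \<noteq> 1" by (auto simp: algebra_simps)
    then show "abelian_power m k (factor s n (k * m)) \<longleftrightarrow> int k \<le> \<lfloor>1 / (1 - \<theta>)\<rfloor>"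
      using ab(3)[OF k I f0] \<theta> by (auto simp: le_floor_iff pos_le_divide_eq)
  qed

  have f_pos: "f > 0" if "r > 0" "f + real r * \<theta> \<in> \<int>" for r
    using orbit_unique[of r 0] that f by (cases "f = 0") auto

  \<comment> \<open>Each boundary equality makes \<open>f + real k * \<theta>\<close> an integer,
    namely 1 or \<open>k\<close>, so it can occur only at \<open>r\<close>.\<close>
  have exc: "f + real k * \<theta> = 1 \<Longrightarrow> k = r" "real k * (1 - \<theta>) = f \<Longrightarrow> k = r"
    if "f + real r * \<theta> \<in> \<int>" for k r
  proof -
    show "k = r" if "f + real k * \<theta> = 1"
      using orbit_unique[OF _ \<open>f + real r * \<theta> \<in> \<int>\<close>, of k] that by simp
    show "k = r" if "real k * (1 - \<theta>) = f"
    proof -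
      have "f + real k * \<theta> = real k" using that by (simp add: algebra_simps)
      then show ?thesis using orbit_unique[OF _ \<open>f + real r * \<theta> \<in> \<int>\<close>, of k] by simp
    qed
  qed

  \<comment> \<open>A boundary equality at \<open>r\<close> would itself put \<open>r\<close> below
    \<open>A\<close> or \<open>B\<close>, so the generic case applies.\<close>
  have large: "int (max_exponent s m n) = max A B"
    if r: "r > 0" "f + real r * \<theta> \<in> \<int>" "int r > max A B" for r
  proof (rule generic)
    show "f \<noteq> 0" using f_pos r by fastforce
    show "f + real k * \<theta> \<noteq> 1" for k
      using exc(1)[OF r(2), of k] A[of "int r"] r(3) f_pos[OF r(1,2)] by auto
    show "real k * (1 - \<theta>) \<noteq> f" for k
      using exc(2)[OF r(2), of k] B[of "int r"] r(3) by auto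
  qed

  have small: "int (max_exponent s m n) = max (A - \<gamma>) (B + \<gamma> - 1)"
    if r: "r > 0" "f + real r * \<theta> \<in> \<int>" "int r \<le> max A B" and \<gamma>: "\<gamma> = (if 0 \<in> Ib then 1 else 0)" for r \<gamma>
  proof -
    have fp: "f > 0" using f_pos[OF r(1,2)] .
    have Ak: "int k \<le> A \<longleftrightarrow> f + real k * \<theta> \<le> 1" for k using A[of "int k"] fp by auto
    have Bk: "int k \<le> B \<longleftrightarrow> real k * (1 - \<theta>) \<le> f" for k using B[of "int k"] by auto
    obtain z where z: "f + real r * \<theta> = of_int z" using r(2) by (auto elim: Ints_cases)
    have r\<theta>: "real r * \<theta> > 0" "real r * \<theta> < real r" using r(1) \<theta> by auto
    \<comment> \<open>The integer \<open>z\<close> lies strictly between 0 and r + 1. If r \<le> A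
      it is at most 1, and if r \<le> B it is at least \<open>r\<close>; either way its value is
      forced.\<close>
    consider (a) "f + real r * \<theta> = 1" | (b) "real r * (1 - \<theta>) = f"
    proof (cases "int r \<le> A")
      case True
      then have "f + real r * \<theta> \<le> 1" using Ak by simp
      then have "z = 1" using z fp r\<theta> by linarith
      then show thesis using z a by simp
    next
      case False
      then have "int r \<le> B" using r(3) by simp
      then have "real r * (1 - \<theta>) \<le> f" using Bk by simp
      then have "real r \<le> f + real r * \<theta>" by (simp add: algebra_simps)
      then have "z = int r" using z f r\<theta> by linarith
      then show thesis using z b by (simp add: algebra_simps)
    qed
    then show ?thesis
    proof cases
      case a
      \<comment> \<open>The boundary index is the last one counted by \<open>A\<close>, so a strict
        inequality lowers \<open>A\<close> by exactly one.\<close>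
      have "A = int r"
      proof (rule antisym)
        show "int r \<le> A" using Ak a by simp
        have "f + real (Suc r) * \<theta> > 1" using a \<theta> by (simp add: algebra_simps)
        then show "A \<le> int r" using Ak[of "Suc r"] by simp
      qed
      \<comment> \<open>This gives B \<le> 1, which settles the coding with 0 outside
        \<open>Ib\<close>: the strict alternative then allows at most k = 1, already covered by A =
        r.\<close>
      have "f < 2 * (1 - \<theta>)"
      proof -
        have "real r * \<theta> \<ge> \<theta>" using r(1) \<theta> by simp
        then show ?thesis using a \<theta> by argo
      qed
      then have "B \<le> 1" using B[of 2] by simp
      show ?thesis
      proof (rule max_exponent_eqI)
        fix k :: nat assume k: "k \<ge> 1"
        have "f + real k * \<theta> = 1 \<longleftrightarrow> k = r" using exc(1)[OF r(2)] a by blast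
        then have lt: "f + real k * \<theta> < 1 \<longleftrightarrow> int k \<le> A - 1"
          unfolding less_le Ak[symmetric] \<open>A = int r\<close> by auto
        show "abelian_power m k (factor s n (k * m)) \<longleftrightarrow> int k \<le> max (A - \<gamma>) (B + \<gamma> - 1)"
        proof (cases "0 \<in> Ib")
          case True
          then show ?thesis using ab(1)[OF k True] lt Bk[of k] \<gamma> by auto
        next
          case False
          have "real k * (1 - \<theta>) < f \<Longrightarrow> int k \<le> A"
            using Bk[of k] \<open>B \<le> 1\<close> \<open>A = int r\<close> r(1) by simp
          then show ?thesis using ab(2)[OF k False fp] Ak[of k] \<gamma> False \<open>B \<le> 1\<close> k by auto
        qed
      qed
    next
      \<comment> \<open>Mirror image under exchanging \<theta> with 1 - \<theta> and
        \<open>f\<close> with 1 - f: now \<open>B\<close> loses one when 0 is outside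
        \<open>Ib\<close>, and A \<le> 1 settles the other coding.\<close>
      case b
      have "B = int r"
      proof (rule antisym)
        show "int r \<le> B" using Bk b by simp
        have "real (Suc r) * (1 - \<theta>) > f" using b \<theta> by (simp add: algebra_simps)
        then show "B \<le> int r" using Bk[of "Suc r"] by simp
      qed
      have "f + 2 * \<theta> > 1"
      proof -
        have "real r * (1 - \<theta>) \<ge> 1 - \<theta>" using r(1) \<theta> by simp
        then show ?thesis using b \<theta> by argo
      qed
      then have "A \<le> 1" using Ak[of 2] by simp
      show ?thesis
      proof (rule max_exponent_eqI)
        fix k :: nat assume k: "k \<ge> 1"
        have "real k * (1 - \<theta>) = f \<longleftrightarrow> k = r" using exc(2)[OF r(2)] b by blast
        then have lt: "real k * (1 - \<theta>) < f \<longleftrightarrow> int k \<le> B - 1"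
          unfolding less_le Bk[symmetric] \<open>B = int r\<close> by auto
        show "abelian_power m k (factor s n (k * m)) \<longleftrightarrow> int k \<le> max (A - \<gamma>) (B + \<gamma> - 1)"
        proof (cases "0 \<in> Ib")
          case True
          have "f + real k * \<theta> < 1 \<Longrightarrow> int k \<le> B"
            using Ak[of k] \<open>A \<le> 1\<close> \<open>B = int r\<close> r(1) by simp
          then show ?thesis using ab(1)[OF k True] Bk[of k] \<gamma> True \<open>A \<le> 1\<close> k by auto
        next
          case False
          then show ?thesis using ab(2)[OF k False fp] lt Ak[of k] \<gamma> by auto
        qed
      qed
    qed
  qed

  have "int (max_exponent s m n) = max A B"
    if "f \<notin> {frac (- (real r * real m * \<alpha>)) | r :: nat. True}"
  proof (rule generic)
    have no: "f + real k * \<theta> \<notin> \<int>" for k using that orbit by auto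
    \<comment> \<open>The excluded orbit contains the index r = 0, which is why f = 0 cannot
      occur.\<close>
    show "f \<noteq> 0" using no[of 0] by auto
    show "f + real k * \<theta> \<noteq> 1" for k using no[of k] by auto
    show "real k * (1 - \<theta>) \<noteq> f" for k
    proof
      assume "real k * (1 - \<theta>) = f"
      then have "f + real k * \<theta> = real k" by (simp add: algebra_simps)
      then show False using no[of k] by simp
    qed
  qed
  then show ?thesis
    unfolding f_def[symmetric] \<theta>_def[symmetric] \<theta>' orbit[symmetric]
    using zero zero' large small unfolding orbit[symmetric] by blast
qed

end
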